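(* Let $\mathcal G=([m],E)$ be a directed tree with the constant coloring $c^*$. Then the vanishing ideal $I_{\hat\varphi}$ of $\mathcal V_{\hat\varphi}$ is a toric ideal after a linear change of coordinates. Hence $\mathcal V_{\hat\varphi}$ and $\mathcal V_{\varphi}$ are toric varieties.
   Context: A directed tree $\mathcal G=([m],E)$ is a directed acyclic graph on $[m]=\{1,\dots,m\}$ whose underlying undirected graph is a tree and which has a unique source node. A trek between $i$ and $j$ is a pair $T=\{P,Q\}$ of directed paths (length zero allowed) with a common starting node, $P$ ending at $i$ and $Q$ ending at $j$; its length is $|T|=|P|+|Q|$ (number of edges). Let $N$ be the length of the longest trek in $\mathcal G$. Under the constant coloring $c^*$ all vertices share one parameter $\omega$ and all edges share one parameter $\lambda$, and the trek polynomial is $p_{i,j}=\sum_T\omega\lambda^{|T|}$, summed over all treks $T$ between $i$ and $j$. Its coefficient vector is $t(i,j)\in\mathbb Z_{\ge0}^{\{0,\dots,N\}}$ ($k$-th entry: coefficient of $\omega\lambda^k$). Let $\mathfrak I=\{(i,j):1\le i\le j\le m\}$. The map $\varphi:\mathbb R^2\to\mathbb R^{\mathfrak I}$ is $(\omega,\lambda)\mapsto(p_{i,j}(\omega,\lambda))_{(i,j)\in\mathfrak I}$. The map $\hat\varphi$ sends $(\omega,\lambda)\in\mathbb R^2$ to the point with coordinates $z_S$, $\emptyset\ne S\subseteq\mathfrak I$, where $z_S=\sum_{k=0}^N a_k\omega\lambda^k$ and $(a_k)_k=\bigwedge_{(i,j)\in S}t(i,j)$ is the coordinatewise minimum. $\mathcal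 V_\varphi,\mathcal V_{\hat\varphi}$ are the Zariski closures of the images of $\varphi,\hat\varphi$, and $I_{\hat\varphi}\subseteq\mathbb R[z_S:\emptyset\ne S\subseteq\mathfrak I]$ is the ideal of polynomials vanishing on $\mathcal V_{\hat\varphi}$. A toric ideal is the kernel of a homomorphism of polynomial rings sending each variable to a monomial. A variety is called toric here if, via an invertible linear change of coordinates on its ambient space, it becomes the Zariski closure of the image of a monomial map. *)

theory Defs
  imports
    "HOL.Real"
    "HOL-Library.FuncSet"
    "HOL-Library.Poly_Mapping"
    "Graph_Theory.Digraph_Component"
begin

section \<open>Directed trees and treks\<close>

text \<open>
  The symmetrization of a digraph has a cycle of two arcs for every edge, so cycles of the
  underlying undirected graph are the cycles of the symmetrization with at least three arcs
  (there are no loops and no pairs of antiparallel arcs, because the digraph is acyclic).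
  In \<open>Graph_Theory\<close>, \<open>connected\<close> refers to the symmetrization and
  excludes the graph without vertices; \<open>tree\<close> only excludes directed cycles and is
  therefore too weak here.
\<close>

definition directed_tree :: "nat pair_pre_digraph \<Rightarrow> bool" where
  "directed_tree G \<longleftrightarrow>
     pair_fin_digraph G \<and>
     (\<nexists>p. pre_digraph.cycle (with_proj G) p) \<and>
     connected (with_proj G) \<and>
     (\<nexists>p. pre_digraph.cycle (with_proj (mk_symmetric (with_proj G))) p \<and> 3 \<le> length p) \<and>
     (\<exists>!v. v \<in> pverts G \<and> in_degree (with_proj G) v = 0)"

text \<open>
  A path is a list of arcs, so the common starting node \<open>k\<close> is stored explicitly.
  The two paths are ordered: \<open>P\<close> ends at \<open>i\<close> and \<open>Q\<close> ends at \<open>j\<close>.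
\<close>

type_synonym trek = "nat \<times> (nat \<times> nat) list \<times> (nat \<times> nat) list"

definition treks :: "nat pair_pre_digraph \<Rightarrow> nat \<Rightarrow> nat \<Rightarrow> trek set" where
  "treks G i j =
     {(k, P, Q). pre_digraph.apath (with_proj G) k P i \<and> pre_digraph.apath (with_proj G) k Q j}"

definition trek_length :: "trek \<Rightarrow> nat" where
  "trek_length = (\<lambda>(k, P, Q). length P + length Q)"

definition max_trek_length :: "nat pair_pre_digraph \<Rightarrow> nat" where
  "max_trek_length G = Max {trek_length T | T i j. T \<in> treks G i j}"


section \<open>Polynomial rings and affine spaces over a finite index set\<close>

text \<open>
  Real polynomials with indeterminates of type \<open>'v\<close>: a finitely supported map from
  exponent vectors to coefficients. The ring of polynomials in the indeterminates from a set
  \<open>V\<close> is the subset \<open>polynomial_ring V\<close>.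
\<close>

type_synonym 'v real_mpoly = "('v \<Rightarrow>\<^sub>0 nat) \<Rightarrow>\<^sub>0 real"

definition polynomial_ring :: "'v set \<Rightarrow> 'v real_mpoly set" where
  "polynomial_ring V = {f. \<forall>m\<in>Poly_Mapping.keys f. Poly_Mapping.keys m \<subseteq> V}"

definition indeterminate :: "'v \<Rightarrow> 'v real_mpoly" where
  "indeterminate v = Poly_Mapping.single (Poly_Mapping.single v 1) 1"

definition monomial :: "('v \<Rightarrow>\<^sub>0 nat) \<Rightarrow> 'v real_mpoly" where
  "monomial a = Poly_Mapping.single a 1"

definition const :: "real \<Rightarrow> 'v real_mpoly" where
  "const c = Poly_Mapping.single 0 c"

text \<open>The homomorphism given by \<open>c\<close> on coefficients and by \<open>g\<close> on indeterminates.\<close>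

definition poly_hom ::
    "(real \<Rightarrow> 'b::comm_semiring_1) \<Rightarrow> ('v \<Rightarrow> 'b) \<Rightarrow> 'v real_mpoly \<Rightarrow> 'b" where
  "poly_hom c g f =
     (\<Sum>m\<in>Poly_Mapping.keys f. c (Poly_Mapping.lookup f m) *
        (\<Prod>v\<in>Poly_Mapping.keys m. g v ^ Poly_Mapping.lookup m v))"

abbreviation poly_eval :: "('v \<Rightarrow> real) \<Rightarrow> 'v real_mpoly \<Rightarrow> real" where
  "poly_eval \<equiv> poly_hom (\<lambda>c. c)"

abbreviation poly_subst ::
    "('v \<Rightarrow> 'w real_mpoly) \<Rightarrow> 'v real_mpoly \<Rightarrow> 'w real_mpoly" where
  "poly_subst \<equiv> poly_hom const"

definition affine_space :: "'v set \<Rightarrow> ('v \<Rightarrow> real) set" where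
  "affine_space V = V \<rightarrow>\<^sub>E UNIV"

definition zero_locus :: "'v set \<Rightarrow> 'v real_mpoly set \<Rightarrow> ('v \<Rightarrow> real) set" where
  "zero_locus V F = {x \<in> affine_space V. \<forall>f\<in>F. poly_eval x f = 0}"

definition zariski_closed :: "'v set \<Rightarrow> ('v \<Rightarrow> real) set \<Rightarrow> bool" where
  "zariski_closed V Z \<longleftrightarrow> (\<exists>F \<subseteq> polynomial_ring V. Z = zero_locus V F)"

definition zariski_closure :: "'v set \<Rightarrow> ('v \<Rightarrow> real) set \<Rightarrow> ('v \<Rightarrow> real) set" where
  "zariski_closure V X = \<Inter>{Z. zariski_closed V Z \<and> X \<subseteq> Z}"

definition vanishing_ideal :: "'v set \<Rightarrow> ('v \<Rightarrow> real) set \<Rightarrow> 'v real_mpoly set" where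
  "vanishing_ideal V X = {f \<in> polynomial_ring V. \<forall>x\<in>X. poly_eval x f = 0}"


section \<open>Linear changes of coordinates and toric objects\<close>

definition invertible_matrix_on :: "'v set \<Rightarrow> ('v \<Rightarrow> 'v \<Rightarrow> real) \<Rightarrow> bool" where
  "invertible_matrix_on V A \<longleftrightarrow>
     (\<exists>B. \<forall>u\<in>V. \<forall>w\<in>V.
        (\<Sum>v\<in>V. A u v * B v w) = (if u = w then 1 else 0) \<and>
        (\<Sum>v\<in>V. B u v * A v w) = (if u = w then 1 else 0))"

definition linear_change_points ::
    "'v set \<Rightarrow> ('v \<Rightarrow> 'v \<Rightarrow> real) \<Rightarrow> ('v \<Rightarrow> real) \<Rightarrow> ('v \<Rightarrow> real)" where
  "linear_change_points V A x = (\<lambda>v\<in>V. \<Sum>w\<in>V. A v w * x w)"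

definition linear_change_poly ::
    "'v set \<Rightarrow> ('v \<Rightarrow> 'v \<Rightarrow> real) \<Rightarrow> 'v real_mpoly \<Rightarrow> 'v real_mpoly" where
  "linear_change_poly V A = poly_subst (\<lambda>v. \<Sum>w\<in>V. const (A v w) * indeterminate w)"

text \<open>
  In both definitions below the indeterminate (coordinate) \<open>v\<close> is sent to the monomial with
  exponent vector \<open>a v\<close> in the \<open>n\<close> indeterminates with index below \<open>n\<close>.
\<close>

definition toric_ideal :: "'v set \<Rightarrow> 'v real_mpoly set \<Rightarrow> bool" where
  "toric_ideal V J \<longleftrightarrow>
     (\<exists>(n::nat) (a :: 'v \<Rightarrow> (nat \<Rightarrow>\<^sub>0 nat)).
        (\<forall>v\<in>V. Poly_Mapping.keys (a v) \<subseteq> {..<n}) \<and>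
        J = {f \<in> polynomial_ring V. poly_subst (\<lambda>v. monomial (a v)) f = 0})"

definition toric_ideal_after_linear_change :: "'v set \<Rightarrow> 'v real_mpoly set \<Rightarrow> bool" where
  "toric_ideal_after_linear_change V J \<longleftrightarrow>
     (\<exists>A. invertible_matrix_on V A \<and> toric_ideal V (linear_change_poly V A ` J))"

definition monomial_map ::
    "'v set \<Rightarrow> ('v \<Rightarrow> ('w \<Rightarrow>\<^sub>0 nat)) \<Rightarrow> ('w \<Rightarrow> real) \<Rightarrow> ('v \<Rightarrow> real)" where
  "monomial_map V a x = (\<lambda>v\<in>V. poly_eval x (monomial (a v)))"

definition toric_variety :: "'v set \<Rightarrow> ('v \<Rightarrow> real) set \<Rightarrow> bool" where
  "toric_variety V X \<longleftrightarrow>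
     (\<exists>A. invertible_matrix_on V A \<and>
        (\<exists>(n::nat) (a :: 'v \<Rightarrow> (nat \<Rightarrow>\<^sub>0 nat)).
           (\<forall>v\<in>V. Poly_Mapping.keys (a v) \<subseteq> {..<n}) \<and>
           linear_change_points V A ` X =
             zariski_closure V (monomial_map V a ` affine_space {..<n})))"


section \<open>Trek polynomials of the constant coloring\<close>

datatype param = Omega | Lambda

definition trek_poly :: "nat pair_pre_digraph \<Rightarrow> nat \<Rightarrow> nat \<Rightarrow> param real_mpoly" where
  "trek_poly G i j =
     (\<Sum>T\<in>treks G i j. indeterminate Omega * indeterminate Lambda ^ trek_length T)"

definition trek_coeff :: "nat pair_pre_digraph \<Rightarrow> nat \<Rightarrow> nat \<Rightarrow> nat \<Rightarrow> real" where
  "trek_coeff G i j k =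
     Poly_Mapping.lookup (trek_poly G i j)
       (Poly_Mapping.single Omega 1 + Poly_Mapping.single Lambda k)"

definition index_pairs :: "nat \<Rightarrow> (nat \<times> nat) set" where
  "index_pairs m = {(i, j). 1 \<le> i \<and> i \<le> j \<and> j \<le> m}"

definition index_subsets :: "nat \<Rightarrow> (nat \<times> nat) set set" where
  "index_subsets m = {S. S \<noteq> {} \<and> S \<subseteq> index_pairs m}"

definition phi :: "nat \<Rightarrow> nat pair_pre_digraph \<Rightarrow> real \<times> real \<Rightarrow> (nat \<times> nat \<Rightarrow> real)" where
  "phi m G = (\<lambda>(w, l). \<lambda>(i, j)\<in>index_pairs m. poly_eval (case_param w l) (trek_poly G i j))"

definition phi_hat ::
    "nat \<Rightarrow> nat pair_pre_digraph \<Rightarrow> real \<times> real \<Rightarrow> ((nat \<times> nat) set \<Rightarrow> real)" where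
  "phi_hat m G = (\<lambda>(w, l). \<lambda>S\<in>index_subsets m.
     \<Sum>k = 0..max_trek_length G. (MIN (i, j)\<in>S. trek_coeff G i j k) * w * l ^ k)"

definition V_phi :: "nat \<Rightarrow> nat pair_pre_digraph \<Rightarrow> (nat \<times> nat \<Rightarrow> real) set" where
  "V_phi m G = zariski_closure (index_pairs m) (range (phi m G))"

definition V_phi_hat :: "nat \<Rightarrow> nat pair_pre_digraph \<Rightarrow> ((nat \<times> nat) set \<Rightarrow> real) set" where
  "V_phi_hat m G = zariski_closure (index_subsets m) (range (phi_hat m G))"

definition I_phi_hat :: "nat \<Rightarrow> nat pair_pre_digraph \<Rightarrow> (nat \<times> nat) set real_mpoly set" where
  "I_phi_hat m G = vanishing_ideal (index_subsets m) (V_phi_hat m G)"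

end

theory Submission
  imports Defs
begin

text \<open>
  Every degree \<open>0, \<dots>, N\<close> in \<open>\<lambda>\<close> is attained by some trek polynomial: a longest trek
  stays a longest trek between its endpoints when its last edge is deleted, because any trek
  between the new endpoints can be extended by that edge again. Hence the trek polynomials span the
  same space as the monomials \<open>\<omega> \<lambda>\<^sup>k\<close>, \<open>k \<le> N\<close>, and a triangular linear change of
  coordinates turns both parametrizations into monomial maps.
\<close>

section \<open>Evaluation of polynomials\<close>

text \<open>The graph enters only through an array of coefficients \<open>c v k\<close> with one
  property: for each \<open>k\<close> up to \<open>N\<close> some coordinate has a nonzero entry at
  \<open>k\<close> and zero entries at the higher degrees up to \<open>N\<close>. Everything about
  varieties and ideals is proved for such arrays, and the array is supplied at the end. Two gaps
  shape the first half. A toric ideal is the kernel of a formal substitution, whereas a vanishing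
  ideal is defined by values at points; the bridge is that a real polynomial is determined by its
  values, which rests on the independence of power products. Secondly, matching Zariski closures
  directly would be awkward, so the linear change is made to carry one parametrized image exactly
  onto the other; closures and ideals then follow formally.\<close>

definition power_product :: "('v \<Rightarrow> real) \<Rightarrow> ('v \<Rightarrow>\<^sub>0 nat) \<Rightarrow> real" where
  "power_product x a = (\<Prod>v\<in>Poly_Mapping.keys a. x v ^ Poly_Mapping.lookup a v)"

lemma power_product_superset:
  assumes "finite S" "Poly_Mapping.keys a \<subseteq> S"
  shows "power_product x a = (\<Prod>v\<in>S. x v ^ Poly_Mapping.lookup a v)"
  unfolding power_product_def using assms
  by (intro prod.mono_neutral_left) (auto simp: in_keys_iff)

lemma power_product_0 [simp]: "power_product x 0 = 1"
  by (simp add: power_product_def)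

lemma power_product_single [simp]: "power_product x (Poly_Mapping.single v k) = x v ^ k"
  by (cases "k = 0") (simp_all add: power_product_def)

lemma power_product_add: "power_product x (a + b) = power_product x a * power_product x b"
proof -
  let ?S = "Poly_Mapping.keys a \<union> Poly_Mapping.keys b"
  have "Poly_Mapping.keys (a + b) \<subseteq> ?S"
    by (rule keys_add)
  then show ?thesis
    by (simp add: power_product_superset[of ?S] lookup_add power_add prod.distrib)
qed

lemma power_product_mult:
  "power_product (\<lambda>v. x v * y v) a = power_product x a * power_product y a"
  by (simp add: power_product_def power_mult_distrib prod.distrib)

lemma power_product_one [simp]: "power_product (\<lambda>v. 1) a = 1"
  by (simp add: power_product_def)

lemma power_product_cong:
  assumes "Poly_Mapping.keys a \<subseteq> V" "\<And>v. v \<in> V \<Longrightarrow> x v = y v"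
  shows "power_product x a = power_product y a"
  unfolding power_product_def using assms by (intro prod.cong) auto

lemma power_product_separates:
  assumes "a \<noteq> b"
  obtains y where "power_product y a \<noteq> power_product y b"
proof -
  obtain v where v: "Poly_Mapping.lookup a v \<noteq> Poly_Mapping.lookup b v"
    using assms by (meson poly_mapping_eqI)
  \<comment> \<open>Powers of 2 are distinct and powers of 1 are not, so the value at
    \<open>y\<close> depends on the exponent of \<open>v\<close> alone.\<close>
  define y :: "'a \<Rightarrow> real" where "y = (\<lambda>_. 1)(v := 2)"
  have "power_product y c = 2 ^ Poly_Mapping.lookup c v" for c
  proof -
    have "power_product y c =
        (\<Prod>u\<in>insert v (Poly_Mapping.keys c). y u ^ Poly_Mapping.lookup c u)"
      by (rule power_product_superset) auto
    also have "\<dots> = (\<Prod>u\<in>{v}. y u ^ Poly_Mapping.lookup c u)"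
      by (rule prod.mono_neutral_right) (auto simp: y_def)
    finally show ?thesis
      by (simp add: y_def)
  qed
  with v have "power_product y a \<noteq> power_product y b"
    by simp
  then show thesis
    by (rule that)
qed

text \<open>Dedekind's independence of characters.\<close>

lemma power_products_independent:
  assumes "finite S" "\<And>x. (\<Sum>a\<in>S. c a * power_product x a) = 0" "a \<in> S"
  shows "c a = 0"
  using assms
proof (induction S arbitrary: c a rule: finite_induct)
  case (insert b S)
  \<comment> \<open>With \<open>y\<close> separating \<open>a'\<close> from \<open>b\<close>, the
    relation at \<open>y * x\<close> minus \<open>power_product y b\<close> times the relation at
    \<open>x\<close> has no \<open>b\<close> term, while \<open>c a'\<close> picks up a nonzero
    factor.\<close>
  have others: "c a' = 0" if "a' \<in> S" for a'
  proof -
    have "a' \<noteq> b"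
      using that insert.hyps by auto
    then obtain y where y: "power_product y a' \<noteq> power_product y b"
      by (rule power_product_separates)
    have "(\<Sum>a\<in>S. (c a * (power_product y a - power_product y b)) * power_product x a) = 0" for x
    proof -
      have "(\<Sum>a\<in>insert b S. c a * power_product (\<lambda>v. y v * x v) a) -
          power_product y b * (\<Sum>a\<in>insert b S. c a * power_product x a) = 0"
        by (simp only: insert.prems(1) mult_zero_right diff_self)
      then show ?thesis
        using insert.hyps
        by (simp add: power_product_mult sum_distrib_left algebra_simps sum_subtractf)
    qed
    from insert.IH[OF this that] y show ?thesis
      by simp
  qed
  have "c b = 0"
    using insert.prems(1)[of "\<lambda>_. 1"] insert.hyps others by simp
  with others insert.prems(2) show ?case
    by auto
qed simp

section \<open>Evaluation as a ring homomorphism\<close>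

lemma poly_eval_altdef:
  "poly_eval x f =
    (\<Sum>a\<in>Poly_Mapping.keys f. Poly_Mapping.lookup f a * power_product x a)"
  by (simp add: poly_hom_def power_product_def)

lemma poly_eval_superset:
  assumes "finite S" "Poly_Mapping.keys f \<subseteq> S"
  shows "poly_eval x f = (\<Sum>a\<in>S. Poly_Mapping.lookup f a * power_product x a)"
  unfolding poly_eval_altdef using assms
  by (intro sum.mono_neutral_left) (auto simp: in_keys_iff)

lemma poly_eval_single [simp]:
  "poly_eval x (Poly_Mapping.single a c) = c * power_product x a"
  by (subst poly_eval_superset[of "{a}"]) auto

lemma poly_eval_const [simp]: "poly_eval x (const c) = c"
  by (simp add: const_def)

lemma poly_eval_monomial [simp]: "poly_eval x (monomial a) = power_product x a"
  by (simp add: monomial_def)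

lemma poly_eval_indeterminate [simp]: "poly_eval x (indeterminate v) = x v"
  by (simp add: indeterminate_def)

lemma poly_eval_0 [simp]: "poly_eval x 0 = 0"
  by (simp add: poly_eval_altdef)

lemma poly_eval_1 [simp]: "poly_eval x 1 = 1"
  using poly_eval_single[of x 0 1] by simp

lemma poly_eval_add: "poly_eval x (f + g) = poly_eval x f + poly_eval x g"
proof -
  let ?S = "Poly_Mapping.keys f \<union> Poly_Mapping.keys g"
  have "Poly_Mapping.keys (f + g) \<subseteq> ?S"
    by (rule keys_add)
  then show ?thesis
    by (simp add: poly_eval_superset[of ?S] lookup_add sum.distrib algebra_simps)
qed

lemma poly_eval_sum: "poly_eval x (\<Sum>i\<in>I. f i) = (\<Sum>i\<in>I. poly_eval x (f i))"
  by (induction I rule: infinite_finite_induct) (simp_all add: poly_eval_add)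

lemma sum_single_lookup:
  "(\<Sum>a\<in>Poly_Mapping.keys f. Poly_Mapping.single a (Poly_Mapping.lookup f a)) = f"
proof (rule poly_mapping_eqI)
  fix b
  have "Poly_Mapping.lookup
      (\<Sum>a\<in>Poly_Mapping.keys f. Poly_Mapping.single a (Poly_Mapping.lookup f a)) b =
      (\<Sum>a\<in>Poly_Mapping.keys f. if a = b then Poly_Mapping.lookup f a else 0)"
    by (auto simp: lookup_sum lookup_single when_def intro!: sum.cong)
  also have "\<dots> = Poly_Mapping.lookup f b"
    by (simp add: in_keys_iff)
  finally show "Poly_Mapping.lookup
      (\<Sum>a\<in>Poly_Mapping.keys f. Poly_Mapping.single a (Poly_Mapping.lookup f a)) b =
      Poly_Mapping.lookup f b" .
qed

text \<open>Both factors are expanded into single terms, on which multiplication adds exponents and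
  \<open>power_product_add\<close> applies.\<close>

lemma poly_eval_mult: "poly_eval x (f * g) = poly_eval x f * poly_eval x g"
proof -
  have "f * g =
      (\<Sum>a\<in>Poly_Mapping.keys f. Poly_Mapping.single a (Poly_Mapping.lookup f a)) *
      (\<Sum>b\<in>Poly_Mapping.keys g. Poly_Mapping.single b (Poly_Mapping.lookup g b))"
    by (simp only: sum_single_lookup)
  then have "poly_eval x (f * g) =
      (\<Sum>a\<in>Poly_Mapping.keys f. \<Sum>b\<in>Poly_Mapping.keys g. poly_eval x
        (Poly_Mapping.single (a + b) (Poly_Mapping.lookup f a * Poly_Mapping.lookup g b)))"
    by (simp only: sum_product mult_single poly_eval_sum)
  then show ?thesis
    by (simp add: power_product_add poly_eval_altdef[of x f] poly_eval_altdef[of x g] sum_product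
        ac_simps)
qed

lemma poly_eval_power: "poly_eval x (f ^ k) = poly_eval x f ^ k"
  by (induction k) (simp_all add: poly_eval_mult)

lemma poly_eval_prod: "poly_eval x (\<Prod>i\<in>I. f i) = (\<Prod>i\<in>I. poly_eval x (f i))"
  by (induction I rule: infinite_finite_induct) (simp_all add: poly_eval_mult)

lemma poly_eval_subst: "poly_eval x (poly_subst g f) = poly_eval (\<lambda>v. poly_eval x (g v)) f"
  by (subst (1 3) poly_hom_def) (simp add: poly_eval_sum poly_eval_mult poly_eval_prod poly_eval_power)

lemma poly_eval_cong:
  assumes "f \<in> polynomial_ring V" "\<And>v. v \<in> V \<Longrightarrow> x v = y v"
  shows "poly_eval x f = poly_eval y f"
  unfolding poly_eval_altdef
  using assms power_product_cong[of _ V x y]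
  by (intro sum.cong refl) (auto simp: polynomial_ring_def)

section \<open>Closure properties of polynomial rings; equality tested on points\<close>

lemma polynomial_ring_0 [simp]: "0 \<in> polynomial_ring V"
  by (simp add: polynomial_ring_def)

lemma polynomial_ring_add:
  "f \<in> polynomial_ring V \<Longrightarrow> g \<in> polynomial_ring V \<Longrightarrow> f + g \<in> polynomial_ring V"
  using keys_add[of f g] by (auto simp: polynomial_ring_def)

lemma polynomial_ring_mult:
  assumes "f \<in> polynomial_ring V" "g \<in> polynomial_ring V"
  shows "f * g \<in> polynomial_ring V"
  unfolding polynomial_ring_def
proof safe
  fix a v
  assume "a \<in> Poly_Mapping.keys (f * g)" and v: "v \<in> Poly_Mapping.keys a"
  then obtain b c where "b \<in> Poly_Mapping.keys f" "c \<in> Poly_Mapping.keys g" "a = b + c"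
    using keys_mult[of f g] by auto
  then show "v \<in> V"
    using assms v keys_add[of b c] unfolding polynomial_ring_def by blast
qed

lemma polynomial_ring_const [simp]: "const c \<in> polynomial_ring V"
  by (simp add: polynomial_ring_def const_def)

lemma polynomial_ring_monomial [simp]:
  "monomial a \<in> polynomial_ring V \<longleftrightarrow> Poly_Mapping.keys a \<subseteq> V"
  by (simp add: polynomial_ring_def monomial_def)

lemma polynomial_ring_indeterminate [simp]: "indeterminate v \<in> polynomial_ring V \<longleftrightarrow> v \<in> V"
  by (simp add: polynomial_ring_def indeterminate_def)

lemma polynomial_ring_1 [simp]: "1 \<in> polynomial_ring V"
  by (simp add: polynomial_ring_def)

lemma polynomial_ring_sum:
  "(\<And>i. i \<in> I \<Longrightarrow> f i \<in> polynomial_ring V) \<Longrightarrow> (\<Sum>i\<in>I. f i) \<in> polynomial_ring V"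
  by (induction I rule: infinite_finite_induct) (simp_all add: polynomial_ring_add)

lemma polynomial_ring_power: "f \<in> polynomial_ring V \<Longrightarrow> f ^ k \<in> polynomial_ring V"
  by (induction k) (simp_all add: polynomial_ring_mult)

lemma polynomial_ring_prod:
  "(\<And>i. i \<in> I \<Longrightarrow> f i \<in> polynomial_ring V) \<Longrightarrow> (\<Prod>i\<in>I. f i) \<in> polynomial_ring V"
  by (induction I rule: infinite_finite_induct) (simp_all add: polynomial_ring_mult)

lemma polynomial_ring_subst:
  assumes "f \<in> polynomial_ring V" "\<And>v. v \<in> V \<Longrightarrow> g v \<in> polynomial_ring W"
  shows "poly_subst g f \<in> polynomial_ring W"
  unfolding poly_hom_def using assms(1)
  by (intro polynomial_ring_sum polynomial_ring_mult polynomial_ring_const polynomial_ring_prod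
      polynomial_ring_power assms(2)) (auto simp: polynomial_ring_def)

text \<open>The coefficient differences give a linear relation between power products that holds at
  every point, so they vanish by independence.\<close>

lemma polynomial_eq_iff_poly_eval:
  assumes "f \<in> polynomial_ring V" "g \<in> polynomial_ring V"
  shows "f = g \<longleftrightarrow> (\<forall>x\<in>affine_space V. poly_eval x f = poly_eval x g)"
proof
  assume eq: "\<forall>x\<in>affine_space V. poly_eval x f = poly_eval x g"
  let ?S = "Poly_Mapping.keys f \<union> Poly_Mapping.keys g"
  have "(\<Sum>a\<in>?S. (Poly_Mapping.lookup f a - Poly_Mapping.lookup g a) * power_product x a) = 0"
    for x
  proof -
    \<comment> \<open>Independence needs the relation for all functions \<open>x\<close>, but points
      of \<open>affine_space V\<close> are undefined outside \<open>V\<close>; restricting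
      \<open>x\<close> to \<open>V\<close> does not change the values of \<open>f\<close> and
      \<open>g\<close>.\<close>
    have "restrict x V \<in> affine_space V"
      by (simp add: affine_space_def)
    then have "poly_eval (restrict x V) f = poly_eval (restrict x V) g"
      using eq by blast
    moreover have "poly_eval (restrict x V) h = poly_eval x h" if "h \<in> polynomial_ring V" for h
      using that by (rule poly_eval_cong) simp
    ultimately have "poly_eval x f = poly_eval x g"
      using assms by simp
    then show ?thesis
      by (simp add: poly_eval_superset[of ?S] left_diff_distrib sum_subtractf)
  qed
  from power_products_independent[OF _ this]
  have "Poly_Mapping.lookup f a = Poly_Mapping.lookup g a" if "a \<in> ?S" for a
    using that by fastforce
  then show "f = g"
    by (intro poly_mapping_eqI) (metis UnI1 UnI2 in_keys_iff)
qed simp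

section \<open>Linear changes of coordinates\<close>

lemma linear_change_points_affine [simp]: "linear_change_points V A x \<in> affine_space V"
  by (simp add: linear_change_points_def affine_space_def)

lemma linear_change_points_inverse:
  assumes "finite V"
    and "\<And>u w. u \<in> V \<Longrightarrow> w \<in> V \<Longrightarrow> (\<Sum>v\<in>V. A u v * B v w) = (if u = w then 1 else 0)"
    and "x \<in> affine_space V"
  shows "linear_change_points V A (linear_change_points V B x) = x"
proof
  fix u
  show "linear_change_points V A (linear_change_points V B x) u = x u"
  proof (cases "u \<in> V")
    case True
    have "(\<Sum>v\<in>V. A u v * (\<Sum>w\<in>V. B v w * x w)) = (\<Sum>w\<in>V. (\<Sum>v\<in>V. A u v * B v w) * x w)"
      by (simp add: sum_distrib_left sum_distrib_right mult.assoc) (rule sum.swap)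
    also have "\<dots> = (\<Sum>w\<in>V. if u = w then x w else 0)"
      using assms(2) True by (intro sum.cong) auto
    also have "\<dots> = x u"
      using assms(1) True by simp
    finally show ?thesis
      using True by (simp add: linear_change_points_def)
  next
    case False
    then show ?thesis
      using assms(3) by (auto simp: linear_change_points_def affine_space_def)
  qed
qed

lemma invertible_matrix_onE:
  assumes "invertible_matrix_on V A" "finite V"
  obtains B where "invertible_matrix_on V B"
    "\<And>x. x \<in> affine_space V \<Longrightarrow> linear_change_points V A (linear_change_points V B x) = x"
    "\<And>x. x \<in> affine_space V \<Longrightarrow> linear_change_points V B (linear_change_points V A x) = x"
proof -
  obtain B where B: "\<And>u w. u \<in> V \<Longrightarrow> w \<in> V \<Longrightarrow>
      (\<Sum>v\<in>V. A u v * B v w) = (if u = w then 1 else 0) \<and>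
      (\<Sum>v\<in>V. B u v * A v w) = (if u = w then 1 else 0)"
    using assms(1) unfolding invertible_matrix_on_def by blast
  show thesis
  proof (rule that)
    show "invertible_matrix_on V B"
      unfolding invertible_matrix_on_def using B by blast
  qed (use B assms(2) in \<open>auto intro!: linear_change_points_inverse\<close>)
qed

lemma poly_eval_linear_change:
  assumes "f \<in> polynomial_ring V"
  shows "poly_eval x (linear_change_poly V A f) = poly_eval (linear_change_points V A x) f"
  unfolding linear_change_poly_def poly_eval_subst using assms
  by (rule poly_eval_cong) (simp add: linear_change_points_def poly_eval_sum poly_eval_mult)

lemma linear_change_poly_ring:
  "f \<in> polynomial_ring V \<Longrightarrow> linear_change_poly V A f \<in> polynomial_ring V"
  unfolding linear_change_poly_def
  by (erule polynomial_ring_subst)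
    (auto intro!: polynomial_ring_sum polynomial_ring_mult)

section \<open>Zariski closures under linear maps\<close>

lemma zariski_closure_subset_affine: "zariski_closure V X \<subseteq> affine_space V" if "X \<subseteq> affine_space V"
proof -
  have "zariski_closed V (affine_space V)"
    unfolding zariski_closed_def by (rule exI[of _ "{}"]) (simp add: zero_locus_def)
  with that show ?thesis
    by (auto simp: zariski_closure_def)
qed

lemma zariski_closure_superset: "X \<subseteq> zariski_closure V X"
  by (auto simp: zariski_closure_def)

lemma zariski_closure_least: "zariski_closed V Z \<Longrightarrow> X \<subseteq> Z \<Longrightarrow> zariski_closure V X \<subseteq> Z"
  by (auto simp: zariski_closure_def)

text \<open>Zariski continuity of linear maps: pulling back the equations of \<open>Z\<close> gives
  equations of the preimage.\<close>

lemma zariski_closed_preimage: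
  assumes "zariski_closed V Z"
  shows "zariski_closed V {x \<in> affine_space V. linear_change_points V A x \<in> Z}"
proof -
  obtain F where F: "F \<subseteq> polynomial_ring V" "Z = zero_locus V F"
    using assms by (auto simp: zariski_closed_def)
  have "{x \<in> affine_space V. linear_change_points V A x \<in> Z} =
      zero_locus V (linear_change_poly V A ` F)"
    using F by (auto simp: zero_locus_def poly_eval_linear_change subset_iff)
  moreover have "linear_change_poly V A ` F \<subseteq> polynomial_ring V"
    using F(1) linear_change_poly_ring by blast
  ultimately show ?thesis
    unfolding zariski_closed_def by blast
qed

lemma linear_change_closure_subset:
  assumes "X \<subseteq> affine_space V"
  shows "linear_change_points V A ` zariski_closure V X \<subseteq>
    zariski_closure V (linear_change_points V A ` X)"
proof -
  have "zariski_closure V X \<subseteq> {x \<in> affine_space V. linear_change_points V A x \<in> Z}"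
    if "zariski_closed V Z" "linear_change_points V A ` X \<subseteq> Z" for Z
    using that assms by (intro zariski_closure_least zariski_closed_preimage) auto
  then show ?thesis
    unfolding zariski_closure_def[of V "linear_change_points V A ` X"] by blast
qed

text \<open>An invertible linear map is a homeomorphism: one inclusion is continuity of
  \<open>A\<close>, the other is continuity of the inverse, applied to the image of
  \<open>X\<close>.\<close>

lemma linear_change_zariski_closure:
  assumes "finite V" "invertible_matrix_on V A" "X \<subseteq> affine_space V"
  shows "linear_change_points V A ` zariski_closure V X =
    zariski_closure V (linear_change_points V A ` X)"
proof
  let ?Y = "linear_change_points V A ` X"
  obtain B where
    AB: "\<And>x. x \<in> affine_space V \<Longrightarrow> linear_change_points V A (linear_change_points V B x) = x"
    and BA: "\<And>x. x \<in> affine_space V \<Longrightarrow> linear_change_points V B (linear_change_points V A x) = x"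
    using assms(2,1) by (rule invertible_matrix_onE) blast
  have Y: "?Y \<subseteq> affine_space V"
    by auto
  have "linear_change_points V B ` ?Y = X"
    using assms(3) BA by (force simp: image_image)
  with linear_change_closure_subset[OF Y, of B]
  have "linear_change_points V B ` zariski_closure V ?Y \<subseteq> zariski_closure V X"
    by simp
  moreover have "y = linear_change_points V A (linear_change_points V B y)"
    if "y \<in> zariski_closure V ?Y" for y
    using that zariski_closure_subset_affine[OF Y] AB by auto
  ultimately show "zariski_closure V ?Y \<subseteq> linear_change_points V A ` zariski_closure V X"
    by blast
qed (rule linear_change_closure_subset[OF assms(3)])

text \<open>The zero locus of a polynomial vanishing on \<open>X\<close> is a closed set containing
  \<open>X\<close>, hence contains the closure.\<close>

lemma vanishing_ideal_zariski_closure: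
  assumes "X \<subseteq> affine_space V"
  shows "vanishing_ideal V (zariski_closure V X) = vanishing_ideal V X"
proof -
  have "poly_eval x f = 0"
    if f: "f \<in> polynomial_ring V" "\<forall>x\<in>X. poly_eval x f = 0" and x: "x \<in> zariski_closure V X"
    for f x
  proof -
    have "zariski_closed V (zero_locus V {f})"
      using f(1) unfolding zariski_closed_def by blast
    moreover have "X \<subseteq> zero_locus V {f}"
      using f(2) assms by (auto simp: zero_locus_def)
    ultimately have "x \<in> zero_locus V {f}"
      using x zariski_closure_least by blast
    then show ?thesis
      by (simp add: zero_locus_def)
  qed
  then show ?thesis
    using zariski_closure_superset[of X V] by (auto simp: vanishing_ideal_def)
qed

section \<open>Toric ideals and varieties from monomial parametrizations\<close>

text \<open>Substituting the monomials into \<open>f\<close> gives a polynomial whose values are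
  those of \<open>f\<close> on the image of the monomial map; it is formally zero iff all these
  values are.\<close>

lemma toric_ideal_monomial_map:
  assumes "\<And>v. v \<in> V \<Longrightarrow> Poly_Mapping.keys (a v) \<subseteq> {..<n}"
  shows "toric_ideal V (vanishing_ideal V (monomial_map V a ` affine_space {..<n::nat}))"
proof -
  have "poly_subst (\<lambda>v. monomial (a v)) f = 0 \<longleftrightarrow>
      (\<forall>x\<in>affine_space {..<n}. poly_eval (monomial_map V a x) f = 0)"
    if f: "f \<in> polynomial_ring V" for f
  proof -
    have "poly_subst (\<lambda>v. monomial (a v)) f \<in> polynomial_ring {..<n}"
      using f by (rule polynomial_ring_subst) (simp add: assms)
    from polynomial_eq_iff_poly_eval[OF this polynomial_ring_0]
    have "poly_subst (\<lambda>v. monomial (a v)) f = 0 \<longleftrightarrow>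
        (\<forall>x\<in>affine_space {..<n}. poly_eval (\<lambda>v. power_product x (a v)) f = 0)"
      by (simp add: poly_eval_subst)
    moreover have "poly_eval (\<lambda>v. power_product x (a v)) f = poly_eval (monomial_map V a x) f" for x
      using f by (rule poly_eval_cong) (simp add: monomial_map_def)
    ultimately show ?thesis
      by simp
  qed
  then show ?thesis
    unfolding toric_ideal_def vanishing_ideal_def
    using assms by (intro exI[of _ n] exI[of _ a]) auto
qed

lemma toric_variety_of_linear_change:
  assumes "finite V" "invertible_matrix_on V A" "X \<subseteq> affine_space V"
    and "\<And>v. v \<in> V \<Longrightarrow> Poly_Mapping.keys (a v) \<subseteq> {..<n}"
    and "linear_change_points V A ` X = monomial_map V a ` affine_space {..<n::nat}"
  shows "toric_variety V (zariski_closure V X)"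
  unfolding toric_variety_def using assms linear_change_zariski_closure[OF assms(1-3)]
  by (intro exI[of _ A] conjI exI[of _ n] exI[of _ a]) auto

text \<open>Polynomials are pulled back along linear maps, so the ideal is moved by the inverse of the
  matrix that moves the points.\<close>

lemma toric_ideal_of_linear_change:
  assumes "finite V" "invertible_matrix_on V A" "X \<subseteq> affine_space V"
    and "\<And>v. v \<in> V \<Longrightarrow> Poly_Mapping.keys (a v) \<subseteq> {..<n}"
    and "linear_change_points V A ` X = monomial_map V a ` affine_space {..<n::nat}"
  shows "toric_ideal_after_linear_change V (vanishing_ideal V (zariski_closure V X))"
proof -
  obtain B where B: "invertible_matrix_on V B"
    and AB: "\<And>x. x \<in> affine_space V \<Longrightarrow> linear_change_points V A (linear_change_points V B x) = x"
    and BA: "\<And>x. x \<in> affine_space V \<Longrightarrow> linear_change_points V B (linear_change_points V A x) = x"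
    using assms(2,1) by (rule invertible_matrix_onE) blast
  have "linear_change_poly V B ` vanishing_ideal V X =
      vanishing_ideal V (linear_change_points V A ` X)"
  proof
    show "linear_change_poly V B ` vanishing_ideal V X \<subseteq>
        vanishing_ideal V (linear_change_points V A ` X)"
      using assms(3) BA
      by (auto simp: vanishing_ideal_def linear_change_poly_ring poly_eval_linear_change subset_iff)
    show "vanishing_ideal V (linear_change_points V A ` X) \<subseteq>
        linear_change_poly V B ` vanishing_ideal V X"
    proof
      fix f
      assume f: "f \<in> vanishing_ideal V (linear_change_points V A ` X)"
      then have ring: "f \<in> polynomial_ring V"
        by (simp add: vanishing_ideal_def)
      have "linear_change_poly V A f \<in> vanishing_ideal V X"
        using f by (auto simp: vanishing_ideal_def linear_change_poly_ring poly_eval_linear_change)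
      \<comment> \<open>Evaluated at \<open>x\<close>, the double pullback is \<open>f\<close> at
        the image of \<open>x\<close> under \<open>B\<close> followed by \<open>A\<close>, which is
        \<open>x\<close>; agreement at all points gives formal equality.\<close>
      moreover have "f = linear_change_poly V B (linear_change_poly V A f)"
        using ring AB
        by (subst polynomial_eq_iff_poly_eval)
          (auto simp: linear_change_poly_ring poly_eval_linear_change)
      ultimately show "f \<in> linear_change_poly V B ` vanishing_ideal V X"
        by blast
    qed
  qed
  with B show ?thesis
    unfolding toric_ideal_after_linear_change_def vanishing_ideal_zariski_closure[OF assms(3)]
    using toric_ideal_monomial_map[of V a n] assms(4,5) by auto
qed

section \<open>Triangular systems and reduction to monomials\<close>

text \<open>Indices are adjoined in order of increasing \<open>rank\<close>. The new index
  \<open>x\<close> has maximal rank, so column \<open>x\<close> vanishes off the diagonal and the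
  enlarged matrix is block lower triangular.\<close>

lemma triangular_matrix_invertible:
  fixes rank :: "'v \<Rightarrow> nat" and A :: "'v \<Rightarrow> 'v \<Rightarrow> real"
  assumes "finite V"
    and "\<And>v. v \<in> V \<Longrightarrow> A v v \<noteq> 0"
    and "\<And>u v. u \<in> V \<Longrightarrow> v \<in> V \<Longrightarrow> u \<noteq> v \<Longrightarrow> rank u \<le> rank v \<Longrightarrow> A u v = 0"
  shows "invertible_matrix_on V A"
  using assms
proof (induction V rule: finite_ranking_induct[where f = rank])
  case empty
  then show ?case
    by (simp add: invertible_matrix_on_def)
next
  case (insert x V)
  show ?case
  \<comment> \<open>The induction rule does not guarantee that \<open>x\<close> is new.\<close>
  proof (cases "x \<in> V")
    case True
    then show ?thesis
      using insert by (simp add: insert_absorb)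
  next
    case False
    have "invertible_matrix_on V A"
      using insert by auto
    then obtain B where B: "\<And>u w. u \<in> V \<Longrightarrow> w \<in> V \<Longrightarrow>
        (\<Sum>v\<in>V. A u v * B v w) = (if u = w then 1 else 0) \<and>
        (\<Sum>v\<in>V. B u v * A v w) = (if u = w then 1 else 0)"
      unfolding invertible_matrix_on_def by blast
    have col: "A u x = 0" if "u \<in> V" for u
      using insert that False by auto
    have diag: "A x x \<noteq> 0"
      using insert by auto
    \<comment> \<open>Block inverse: if the old block has inverse \<open>B\<close>, the new row is
      \<open>r\<close> and the corner is \<open>d\<close>, the inverse has row
      \<open>- r B / d\<close> and corner \<open>1 / d\<close>.\<close>
    define C where "C u w =
      (if u = x then if w = x then 1 / A x x else - (\<Sum>v\<in>V. A x v * B v w) / A x x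
       else if w = x then 0 else B u w)" for u w
    have C: "C x x = 1 / A x x" "u \<in> V \<Longrightarrow> C u x = 0" "u \<in> V \<Longrightarrow> w \<in> V \<Longrightarrow> C u w = B u w"
      "w \<in> V \<Longrightarrow> C x w = - (\<Sum>v\<in>V. A x v * B v w) / A x x" for u w
      using False by (auto simp: C_def)
    have row: "(\<Sum>v\<in>V. (\<Sum>u\<in>V. A x u * B u v) * A v w) = A x w" if "w \<in> V" for w
    proof -
      have "(\<Sum>v\<in>V. (\<Sum>u\<in>V. A x u * B u v) * A v w) = (\<Sum>u\<in>V. A x u * (\<Sum>v\<in>V. B u v * A v w))"
        by (simp add: sum_distrib_left sum_distrib_right mult.assoc) (rule sum.swap)
      also have "\<dots> = (\<Sum>u\<in>V. if u = w then A x u else 0)"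
        using B that by (intro sum.cong) auto
      finally show ?thesis
        using that insert.hyps by simp
    qed
    have "(\<Sum>v\<in>insert x V. A u v * C v w) = (if u = w then 1 else 0) \<and>
        (\<Sum>v\<in>insert x V. C u v * A v w) = (if u = w then 1 else 0)"
      if uw: "u \<in> insert x V" "w \<in> insert x V" for u w
    proof -
      consider "u = x" "w = x" | "u = x" "w \<in> V" | "u \<in> V" "w = x" | "u \<in> V" "w \<in> V"
        using uw by blast
      then show ?thesis
      proof cases
        case 1
        then show ?thesis
          using False insert.hyps diag by (simp add: C col)
      next
        case 2
        then have "u \<noteq> w"
          using False by auto
        moreover have "(\<Sum>v\<in>V. C x v * A v w) = - A x w / A x x"
        proof -
          have "(\<Sum>v\<in>V. C x v * A v w) = (\<Sum>v\<in>V. (\<Sum>u\<in>V. A x u * B u v) * A v w) * (- 1 / A x x)"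
            unfolding sum_distrib_right[of _ V "- 1 / A x x"]
            by (intro sum.cong refl) (simp add: C)
          then show ?thesis
            by (simp add: row[OF 2(2)])
        qed
        ultimately show ?thesis
          using False insert.hyps diag 2 by (simp add: C)
      next
        case 3
        then have "u \<noteq> w"
          using False by auto
        then show ?thesis
          using False insert.hyps 3 by (simp add: C col)
      next
        case 4
        then show ?thesis
          using False insert.hyps B[OF 4] by (simp add: C col)
      qed
    qed
    then show ?thesis
      unfolding invertible_matrix_on_def by blast
  qed
qed

text \<open>A toric parametrization has no zero coordinates, so the coordinates that are not needed to
  produce the monomials \<open>w l\<^sup>k\<close> cannot be reduced to zero; they are all reduced to the
  monomial \<open>w\<close> instead.\<close>

lemma linear_change_to_monomials:
  fixes c :: "'v \<Rightarrow> nat \<Rightarrow> real" and N :: nat and V :: "'v set"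
  defines "F \<equiv> \<lambda>(w, l). \<lambda>v\<in>V. \<Sum>k = 0..N. c v k * w * l ^ k"
  assumes "finite V"
    and "\<And>k. k \<le> N \<Longrightarrow> \<exists>v\<in>V. c v k \<noteq> 0 \<and> (\<forall>l. k < l \<and> l \<le> N \<longrightarrow> c v l = 0)"
  obtains A a where "invertible_matrix_on V A"
    and "\<And>v. v \<in> V \<Longrightarrow> Poly_Mapping.keys (a v) \<subseteq> {..<2::nat}"
    and "linear_change_points V A ` range F = monomial_map V a ` affine_space {..<2}"
proof -
  \<comment> \<open>\<open>p k\<close> is a coordinate whose polynomial has degree exactly
    \<open>k\<close> in \<open>l\<close>.\<close>
  obtain p where p: "\<And>k. k \<le> N \<Longrightarrow> p k \<in> V \<and> c (p k) k \<noteq> 0"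
    and p_top: "\<And>k l. k < l \<Longrightarrow> l \<le> N \<Longrightarrow> c (p k) l = 0"
    using assms(3) by (metis order.strict_trans2 less_imp_le)
  have inj: "inj_on p {..N}"
  proof (rule linorder_inj_onI)
    fix k l assume "k < l" "l \<in> {..N}"
    then show "p k \<noteq> p l"
      using p[of l] p_top[of k l] by auto
  qed auto
  define U where "U = p ` {..N}"
  \<comment> \<open>The exponent of \<open>l\<close> that coordinate \<open>v\<close> is to
    receive.\<close>
  define e where "e v = (if v \<in> U then inv_into {..N} p v else 0)" for v
  have e_p: "e (p k) = k" if "k \<le> N" for k
    using inj that by (simp add: e_def U_def)
  have p_e: "p (e v) = v" "e v \<le> N" if "v \<in> U" for v
    using that e_p by (auto simp: U_def)
  have U: "U \<subseteq> V"
    using p by (auto simp: U_def)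
  have p0: "p 0 \<in> U" "e (p 0) = 0"
    using e_p by (auto simp: U_def)
  \<comment> \<open>\<open>B\<close> leads from the monomials to \<open>F\<close>, the direction in
    which the entries are simply coefficients; its inverse is the change sought. A row outside
    \<open>U\<close> also gets 1 at itself and -1 at \<open>p 0\<close>: both coordinates equal
    \<open>w\<close>, so the result is unchanged but the diagonal entry becomes nonzero.\<close>
  define B where "B u v = (if v \<in> U then c u (e v) else 0) +
    (if u \<in> U then 0 else (if v = u then 1 else 0) - (if v = p 0 then 1 else 0))" for u v
  \<comment> \<open>Rows outside \<open>U\<close> may use every column in \<open>U\<close>, whereas
    rows in \<open>U\<close> use no column outside it; hence the spare coordinates are ranked above
    all of \<open>U\<close>.\<close>
  define rank where "rank v = (if v \<in> U then e v else Suc N)" for v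
  define M where "M = (\<lambda>(w, l). \<lambda>v\<in>V. w * l ^ e v :: real)"
  have "invertible_matrix_on V B"
  proof (rule triangular_matrix_invertible[OF assms(2), of B rank])
    fix v assume "v \<in> V"
    show "B v v \<noteq> 0"
    proof (cases "v \<in> U")
      case True
      then show ?thesis
        using p[of "e v"] p_e[of v] by (simp add: B_def)
    qed (use p0 in \<open>auto simp: B_def\<close>)
  next
    fix u v assume uv: "u \<noteq> v" "rank u \<le> rank v"
    show "B u v = 0"
    proof (cases "u \<in> U")
      case True
      then have "e u < e v" if "v \<in> U"
        using uv p_e that by (metis rank_def le_neq_implies_less)
      then show ?thesis
        using True p_top[of "e u" "e v"] p_e by (auto simp: B_def)
    next
      case False
      then have "v \<notin> U"
        using uv p_e(2)[of v] by (auto simp: rank_def split: if_splits)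
      then show ?thesis
        using uv False p0 by (auto simp: B_def)
    qed
  qed
  then obtain A where A: "invertible_matrix_on V A"
    and AB: "\<And>x. x \<in> affine_space V \<Longrightarrow> linear_change_points V A (linear_change_points V B x) = x"
    using assms(2) by (rule invertible_matrix_onE) blast
  have BM: "linear_change_points V B (M (w, l)) = F (w, l)" for w l
  proof
    fix u
    show "linear_change_points V B (M (w, l)) u = F (w, l) u"
    proof (cases "u \<in> V")
      case True
      have "(\<Sum>v\<in>V. B u v * (w * l ^ e v)) =
          (\<Sum>v\<in>V. if v \<in> U then c u (e v) * (w * l ^ e v) else 0) +
          (if u \<in> U then 0 else (\<Sum>v\<in>V. if v = u then w * l ^ e v else 0) -
            (\<Sum>v\<in>V. if v = p 0 then w * l ^ e v else 0))"
        by (auto simp: B_def distrib_right left_diff_distrib sum.distrib sum_subtractf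
            intro!: sum.cong arg_cong2[where f = "(+)"] arg_cong2[where f = "(-)"])
      also have "(if u \<in> U then 0 else (\<Sum>v\<in>V. if v = u then w * l ^ e v else 0) -
            (\<Sum>v\<in>V. if v = p 0 then w * l ^ e v else 0)) = 0"
        using True assms(2) U p0 by (auto simp: e_def[of u])
      also have "(\<Sum>v\<in>V. if v \<in> U then c u (e v) * (w * l ^ e v) else 0) =
          (\<Sum>v\<in>U. c u (e v) * (w * l ^ e v))"
        using assms(2) U by (simp add: sum.inter_restrict[symmetric] Int_absorb1)
      also have "\<dots> = (\<Sum>k\<le>N. c u k * (w * l ^ k))"
        unfolding U_def using e_p by (simp add: sum.reindex[OF inj])
      finally show ?thesis
        using True by (simp add: linear_change_points_def M_def F_def atLeast0AtMost mult.assoc)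
    qed (simp add: linear_change_points_def F_def)
  qed
  have "M x \<in> affine_space V" for x
    by (simp add: M_def affine_space_def split: prod.split)
  then have AF: "linear_change_points V A (F x) = M x" for x
    using AB[of "M x"] BM by (cases x) simp
  \<comment> \<open>Indeterminate 0 plays the role of \<open>w\<close>, indeterminate 1 that of
    \<open>l\<close>.\<close>
  define a where "a v = Poly_Mapping.single 0 1 + Poly_Mapping.single (1::nat) (e v)" for v
  have M_mono: "monomial_map V a x = M (x 0, x 1)" for x
    by (simp add: monomial_map_def M_def a_def power_product_add)
  have "linear_change_points V A ` range F = monomial_map V a ` affine_space {..<2}"
  proof -
    have "(w, l) \<in> (\<lambda>x. (x 0, x 1)) ` affine_space {..<2::nat}" for w l :: real
      by (rule image_eqI[of _ _ "restrict (\<lambda>i. if i = 0 then w else l) {..<2}"])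
        (auto simp: affine_space_def)
    then have "(\<lambda>x. (x 0, x 1)) ` affine_space {..<2::nat} = (UNIV :: (real \<times> real) set)"
      by auto
    then have "M ` (\<lambda>x. (x 0, x 1)) ` affine_space {..<2::nat} = range M"
      by simp
    then show ?thesis
      by (simp add: image_image AF M_mono)
  qed
  moreover have "Poly_Mapping.keys (a v) \<subseteq> {..<2}" for v
    unfolding a_def by (rule order.trans[OF keys_add]) auto
  ultimately show thesis
    using A that by blast
qed

lemma toric_of_graded_parametrization:
  fixes c :: "'v \<Rightarrow> nat \<Rightarrow> real" and N :: nat and V :: "'v set"
  defines "F \<equiv> \<lambda>(w, l). \<lambda>v\<in>V. \<Sum>k = 0..N. c v k * w * l ^ k"
  assumes "finite V"
    and "\<And>k. k \<le> N \<Longrightarrow> \<exists>v\<in>V. c v k \<noteq> 0 \<and> (\<forall>l. k < l \<and> l \<le> N \<longrightarrow> c v l = 0)"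
  shows "toric_variety V (zariski_closure V (range F))"
    and "toric_ideal_after_linear_change V (vanishing_ideal V (zariski_closure V (range F)))"
proof -
  obtain A a where Aa: "invertible_matrix_on V A"
    "\<And>v. v \<in> V \<Longrightarrow> Poly_Mapping.keys (a v) \<subseteq> {..<2::nat}"
    "linear_change_points V A ` range F = monomial_map V a ` affine_space {..<2}"
    using assms(2,3) unfolding F_def by (rule linear_change_to_monomials) blast+
  have "range F \<subseteq> affine_space V"
    by (auto simp: F_def affine_space_def)
  with Aa assms(2) show "toric_variety V (zariski_closure V (range F))"
    and "toric_ideal_after_linear_change V (vanishing_ideal V (zariski_closure V (range F)))"
    by (blast intro: toric_variety_of_linear_change toric_ideal_of_linear_change)+
qed

section \<open>Degrees of trek polynomials\<close>

lemma treks_swap: "(k, P, Q) \<in> treks G i j \<longleftrightarrow> (k, Q, P) \<in> treks G j i"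
  by (auto simp: treks_def)

text \<open>A repeated vertex would yield a closed walk and hence a cycle. Walks, unlike paths, can
  be extended without a distinctness check.\<close>

lemma (in wf_digraph) acyclic_apath_iff_awalk:
  assumes "\<nexists>p. cycle p"
  shows "apath u p v \<longleftrightarrow> awalk u p v"
proof
  assume walk: "awalk u p v"
  have "distinct (awalk_verts u p)"
  proof (rule ccontr)
    assume "\<not> distinct (awalk_verts u p)"
    then obtain r where "closed_w r"
      using awalk_not_distinct_decomp[OF walk] by (auto simp: closed_w_def)
    then show False
      using closed_w_imp_cycle assms by blast
  qed
  with walk show "apath u p v"
    by (auto simp: apath_def)
qed (simp add: apath_def)

text \<open>Fixes the vertex type to \<open>nat\<close>, the only type for which
  \<open>treks\<close> and the trek polynomials are defined.\<close>

locale nat_fin_digraph = pair_fin_digraph G for G :: "nat pair_pre_digraph"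
begin

section \<open>Finiteness of treks and the coefficients that count them\<close>

lemma finite_treks: "finite (treks G i j)"
proof (rule finite_subset)
  let ?X = "{(u, p, v). apath u p v}"
  show "treks G i j \<subseteq> (\<lambda>((k, P, _), (_, Q, _)). (k, P, Q)) ` (?X \<times> ?X)"
    by (force simp: treks_def)
  show "finite ((\<lambda>((k, P, _), (_, Q, _)). (k, P, Q)) ` (?X \<times> ?X))"
    using apaths_finite_triple by blast
qed

lemma finite_trek_lengths: "finite {trek_length T | T i j. T \<in> treks G i j}"
proof (rule finite_subset)
  show "{trek_length T | T i j. T \<in> treks G i j} \<subseteq> {..card (pverts G) + card (pverts G)}"
    by (auto simp: treks_def trek_length_def intro!: add_mono less_imp_le[OF length_apath_less])
qed simp

lemma trek_length_le_max: "T \<in> treks G i j \<Longrightarrow> trek_length T \<le> max_trek_length G"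
  unfolding max_trek_length_def using finite_trek_lengths by (intro Max_ge) blast+

lemma trek_poly_altdef:
  "trek_poly G i j = (\<Sum>T\<in>treks G i j. Poly_Mapping.single
     (Poly_Mapping.single Omega 1 + Poly_Mapping.single Lambda (trek_length T)) 1)"
proof -
  have "indeterminate Lambda ^ n = Poly_Mapping.single (Poly_Mapping.single Lambda n) 1" for n
    by (induction n) (simp_all add: indeterminate_def mult_single flip: single_add)
  then show ?thesis
    by (simp add: trek_poly_def indeterminate_def mult_single)
qed

lemma trek_coeff_altdef: "trek_coeff G i j k = (\<Sum>T\<in>treks G i j. if trek_length T = k then 1 else 0)"
proof -
  have "Poly_Mapping.single Omega 1 + Poly_Mapping.single Lambda n =
      Poly_Mapping.single Omega 1 + Poly_Mapping.single Lambda k \<longleftrightarrow> n = k" for n :: nat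
    by (metis add_left_cancel lookup_single_eq)
  then show ?thesis
    by (simp add: trek_coeff_def trek_poly_altdef lookup_sum lookup_single when_def)
qed

lemma trek_coeff_eq_card: "trek_coeff G i j k = card {T \<in> treks G i j. trek_length T = k}"
  by (simp add: trek_coeff_altdef sum.If_cases[OF finite_treks] Int_def)

lemma trek_coeff_eq_0_iff: "trek_coeff G i j k = 0 \<longleftrightarrow> (\<forall>T\<in>treks G i j. trek_length T \<noteq> k)"
  using finite_treks[of i j] by (auto simp: trek_coeff_eq_card simp del: split_paired_All)

text \<open>Treks are grouped by length, and none is longer than the upper limit. This gives
  \<open>phi\<close> the same shape as \<open>phi_hat\<close>, so that one criterion covers
  both.\<close>

lemma poly_eval_trek_poly:
  "poly_eval (case_param w l) (trek_poly G i j) =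
    (\<Sum>k = 0..max_trek_length G. trek_coeff G i j k * w * l ^ k)"
proof -
  have "(\<Sum>k = 0..max_trek_length G. trek_coeff G i j k * w * l ^ k) =
      (\<Sum>k = 0..max_trek_length G. \<Sum>T\<in>treks G i j. if trek_length T = k then w * l ^ k else 0)"
    by (auto simp: trek_coeff_altdef sum_distrib_right intro!: sum.cong)
  also have "\<dots> =
      (\<Sum>T\<in>treks G i j. \<Sum>k = 0..max_trek_length G. if trek_length T = k then w * l ^ k else 0)"
    by (rule sum.swap)
  also have "\<dots> = (\<Sum>T\<in>treks G i j. w * l ^ trek_length T)"
    by (intro sum.cong refl) (auto simp: trek_length_le_max)
  finally show ?thesis
    by (simp add: trek_poly_altdef poly_eval_sum power_product_add)
qed

section \<open>Descent from a longest trek\<close>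

text \<open>Maximality is required only among treks with the same endpoints and is reproduced in the
  conclusion, so the step can be iterated.\<close>

lemma shorten_longest_trek:
  assumes "\<nexists>p. cycle p"
    and "(k, P, Q) \<in> treks G i j" "P \<noteq> []"
    and "\<And>T. T \<in> treks G i j \<Longrightarrow> trek_length T \<le> trek_length (k, P, Q)"
  obtains i' P' where "(k, P', Q) \<in> treks G i' j"
    "trek_length (k, P, Q) = Suc (trek_length (k, P', Q))"
    "\<And>T. T \<in> treks G i' j \<Longrightarrow> trek_length T \<le> trek_length (k, P', Q)"
proof -
  note walk = acyclic_apath_iff_awalk[OF assms(1)]
  obtain P' e where P: "P = P' @ [e]"
    using assms(3) by (cases P rule: rev_cases) auto
  then obtain i' where i': "awalk k P' i'" "awalk i' [e] i"
    using assms(2) by (auto simp: treks_def walk)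
  show thesis
  proof (rule that)
    show "(k, P', Q) \<in> treks G i' j"
      using assms(2) i' by (auto simp: treks_def walk)
    show "trek_length (k, P, Q) = Suc (trek_length (k, P', Q))"
      by (simp add: P trek_length_def)
    fix T assume T: "T \<in> treks G i' j"
    obtain k2 P2 Q2 where T_eq: "T = (k2, P2, Q2)"
      by (cases T)
    \<comment> \<open>Nothing is known about the vertices of \<open>P2\<close>; acyclicity still
      makes the extended walk a path.\<close>
    have "(k2, P2 @ [e], Q2) \<in> treks G i j"
      using T i'(2) awalk_appendI by (auto simp: T_eq treks_def walk)
    from assms(4)[OF this] show "trek_length T \<le> trek_length (k, P', Q)"
      by (simp add: T_eq P trek_length_def)
  qed
qed

text \<open>Downward induction from the maximal length; maximality between the endpoints is the
  invariant, since it makes \<open>n\<close> the top degree of that trek polynomial.\<close>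

lemma every_degree_attained:
  assumes "\<nexists>p. cycle p" "pverts G \<noteq> {}" "n \<le> max_trek_length G"
  shows "\<exists>i j. \<exists>T\<in>treks G i j. trek_length T = n \<and> (\<forall>T'\<in>treks G i j. trek_length T' \<le> n)"
  using assms(3)
proof (induction rule: inc_induct)
  case base
  obtain v where "v \<in> pverts G"
    using assms(2) by blast
  \<comment> \<open>The empty trek makes the set of lengths nonempty, so its \<open>Max\<close> is
    attained.\<close>
  then have "(v, [], []) \<in> treks G v v"
    by (simp add: treks_def apath_Nil_iff)
  then have "{trek_length T | T i j. T \<in> treks G i j} \<noteq> {}"
    by blast
  from Max_in[OF finite_trek_lengths this] obtain T i j
    where "T \<in> treks G i j" "trek_length T = max_trek_length G"
    unfolding max_trek_length_def by auto
  then show ?case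
    using trek_length_le_max by blast
next
  case (step n)
  then obtain i j k P Q where T: "(k, P, Q) \<in> treks G i j" "trek_length (k, P, Q) = Suc n"
    and max: "\<And>T. T \<in> treks G i j \<Longrightarrow> trek_length T \<le> Suc n"
    by auto
  show ?case
  proof (cases "P = []")
    case False
    obtain i' P' where T': "(k, P', Q) \<in> treks G i' j" "Suc n = Suc (trek_length (k, P', Q))"
      "\<And>T. T \<in> treks G i' j \<Longrightarrow> trek_length T \<le> trek_length (k, P', Q)"
      using shorten_longest_trek[OF assms(1) T(1) False] max unfolding T(2) by blast
    then show ?thesis
      by blast
  next
    \<comment> \<open>Positive length forces the other arm to be nonempty, and exchanging the arms
      reduces to the shortening lemma.\<close>
    case True
    then have "Q \<noteq> []"
      using T(2) by (auto simp: trek_length_def)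
    have swap: "(k, Q, P) \<in> treks G j i" "trek_length (k, Q, P) = Suc n"
      using T treks_swap by (auto simp: trek_length_def)
    have "trek_length T \<le> Suc n" if "T \<in> treks G j i" for T
    proof -
      obtain k2 P2 Q2 where T_eq: "T = (k2, P2, Q2)"
        by (cases T)
      have "(k2, Q2, P2) \<in> treks G i j"
        using that unfolding T_eq by (subst treks_swap)
      from max[OF this] show ?thesis
        by (simp add: T_eq trek_length_def)
    qed
    then obtain j' Q' where T': "(k, Q', P) \<in> treks G j' i"
      "Suc n = Suc (trek_length (k, Q', P))"
      "\<And>T. T \<in> treks G j' i \<Longrightarrow> trek_length T \<le> trek_length (k, Q', P)"
      using shorten_longest_trek[OF assms(1) swap(1) \<open>Q \<noteq> []\<close>] unfolding swap(2) by blast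
    then show ?thesis
      by blast
  qed
qed

text \<open>\<open>index_pairs\<close> contains only pairs with \<open>i \<le> j\<close>, while the
  descent may end with the endpoints in either order.\<close>

lemma trek_coeff_commute: "trek_coeff G i j k = trek_coeff G j i k"
proof -
  have "bij_betw (\<lambda>(k, P, Q). (k, Q, P))
      {T \<in> treks G i j. trek_length T = k} {T \<in> treks G j i. trek_length T = k}"
    by (rule bij_betw_byWitness[where f' = "\<lambda>(k, P, Q). (k, Q, P)"])
      (auto simp: treks_def trek_length_def)
  then show ?thesis
    by (simp add: trek_coeff_eq_card bij_betw_same_card)
qed

lemma trek_poly_degree_attained:
  assumes "\<nexists>p. cycle p" "pverts G = {1..m}" "m \<noteq> 0" "n \<le> max_trek_length G"
  shows "\<exists>(i, j)\<in>index_pairs m. trek_coeff G i j n \<noteq> 0 \<and> (\<forall>k>n. trek_coeff G i j k = 0)"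
proof -
  have "pverts G \<noteq> {}"
    using assms(2,3) by simp
  from every_degree_attained[OF assms(1) this assms(4)] obtain i j T
    where T: "T \<in> treks G i j" "trek_length T = n" "\<forall>T'\<in>treks G i j. trek_length T' \<le> n"
    by blast
  have coeff: "trek_coeff G i j n \<noteq> 0" "\<forall>k>n. trek_coeff G i j k = 0"
    using T by (auto simp: trek_coeff_eq_0_iff)
  have "i \<in> pverts G" "j \<in> pverts G"
    using T(1) by (auto simp: treks_def apath_def)
  then have "(i, j) \<in> index_pairs m \<or> (j, i) \<in> index_pairs m"
    using assms(2) by (auto simp: index_pairs_def)
  then show ?thesis
    using coeff coeff[unfolded trek_coeff_commute[of i j]] by blast
qed

end

theorem proposition6p1:
  fixes m :: nat and G :: "nat pair_pre_digraph"
  assumes "pverts G = {1..m}"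
    and "directed_tree G"
  shows "toric_ideal_after_linear_change (index_subsets m) (I_phi_hat m G)
    \<and> toric_variety (index_subsets m) (V_phi_hat m G)
    \<and> toric_variety (index_pairs m) (V_phi m G)"
proof -
  interpret nat_fin_digraph G
    using assms(2) by (simp add: directed_tree_def nat_fin_digraph_def)
  have acyclic: "\<nexists>p. cycle p"
    using assms(2) by (simp add: directed_tree_def)
  have "m \<noteq> 0"
    using assms by (intro notI) (simp add: directed_tree_def connected_def strongly_connected_def)
  note deg = trek_poly_degree_attained[OF acyclic assms(1) this]
  have fin_pairs: "finite (index_pairs m)"
    by (rule finite_subset[of _ "{1..m} \<times> {1..m}"]) (auto simp: index_pairs_def)
  then have fin_subsets: "finite (index_subsets m)"
    by (simp add: index_subsets_def)
  define c where "c v k = trek_coeff G (fst v) (snd v) k" for v k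
  define c_hat where "c_hat S k = (MIN (i, j)\<in>S. trek_coeff G i j k)" for S k
  have phi: "phi m G = (\<lambda>(w, l). \<lambda>v\<in>index_pairs m. \<Sum>k = 0..max_trek_length G. c v k * w * l ^ k)"
    by (auto simp: phi_def c_def poly_eval_trek_poly fun_eq_iff restrict_def)
  have phi_hat: "phi_hat m G =
      (\<lambda>(w, l). \<lambda>S\<in>index_subsets m. \<Sum>k = 0..max_trek_length G. c_hat S k * w * l ^ k)"
    by (simp add: phi_hat_def c_hat_def)
  have c: "\<exists>v\<in>index_pairs m. c v n \<noteq> 0 \<and> (\<forall>k. n < k \<and> k \<le> max_trek_length G \<longrightarrow> c v k = 0)"
    if "n \<le> max_trek_length G" for n
    using deg[OF that] by (force simp: c_def)
  have c_hat: "\<exists>S\<in>index_subsets m. c_hat S n \<noteq> 0 \<and>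
      (\<forall>k. n < k \<and> k \<le> max_trek_length G \<longrightarrow> c_hat S k = 0)"
    if n: "n \<le> max_trek_length G" for n
  proof -
    obtain v where v: "v \<in> index_pairs m" "c v n \<noteq> 0"
      "\<forall>k. n < k \<and> k \<le> max_trek_length G \<longrightarrow> c v k = 0"
      using c[OF n] by blast
    \<comment> \<open>A minimum over a singleton is the trek coefficient itself, so the coordinates
      of \<open>phi\<close> reappear in \<open>phi_hat\<close> and again attain every
      degree.\<close>
    have "c_hat {v} k = c v k" for k
      by (simp add: c_hat_def c_def split_beta)
    with v show ?thesis
      by (intro bexI[of _ "{v}"]) (auto simp: index_subsets_def)
  qed
  show ?thesis
    unfolding I_phi_hat_def V_phi_hat_def V_phi_def phi phi_hat
    using toric_of_graded_parametrization[OF fin_pairs c]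
      toric_of_graded_parametrization[OF fin_subsets c_hat] by blast
qed

end
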